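(* Let $a,u,v,q$ be complex parameters (generic, so that no denominator vanishes). Let $K_0(n):=K(a,q^{-n},q^{1-n},q^{2-n},a,u,v,q^3)$ and $K_0'(n):=K(aq,q^{-n},q^{1-n},q^{2-n},aq,u,v,q^3)$, and put \[ A_r:=\frac{(aq,q^3u,q^3v,aq^4/u,aq^4/v;q^3)_r}{(u,v,aq/u,aq/v,q^3;q^3)_r}. \] (i) The sequences with $\alpha_0=\beta_0=1$, $\alpha_{3r+1}=\alpha_{3r+2}=0$ ($r\ge0$), \[ \alpha_{3r}=\frac{1-aq^{6r}}{1-a}\,\frac{(a,q^3u,q^3v,aq^3/u,aq^3/v;q^3)_r}{(u,v,a/u,a/v,q^3;q^3)_r}\,q^{\frac{9r^2-15r}{2}}(-a)^r,\qquad \beta_n=K_0(n)\frac{(a;q^3)_n}{(a;q)_{2n}(q;q)_n}, \] form a Bailey pair relative to $a$. (ii) The sequences with $\alpha_0=\beta_0=1$, $\alpha_{3r-1}=0$ ($r\ge1$), and for $r\ge0$ \[ \alpha_{3r}=A_r\,q^{\frac{9r^2-13r}{2}}(-a)^r,\quad \alpha_{3r+1}=A_r\,q^{\frac{9r^2-r}{2}+1}(-a)^{r+1},\quad \beta_n=K_0'(n)\frac{(aq;q^3)_n}{(aq;q)_{2n}(q;q)_n}, \] form a Bailey pair relative to $a$. (iii) The sequences with $\alpha_0=\beta_0=1$, $\alpha_{3r-1}=0$ ($r\ge1$), and for $r\ge0$ \[ \alpha_{3r}=A_r\,q^{\frac{9r^2-7r}{2}}(-a)^r,\quad \alpha_{3r+1}=-A_r\,q^{\frac{9r^2-7r}{2}}(-a)^{r},\quad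 \beta_n=K_0'(n)\frac{(aq;q^3)_n\,q^n}{(aq;q)_{2n}(q;q)_n}, \] form a Bailey pair relative to $a$.
   Context: Notation: $(x;q)_n=\prod_{k=0}^{n-1}(1-xq^k)$ and $(x_1,\dots,x_k;q)_n=(x_1;q)_n\cdots(x_k;q)_n$. A pair of sequences $(\alpha_n)_{n\ge0},(\beta_n)_{n\ge0}$ is a Bailey pair relative to $a$ if $\alpha_0=1$ and $\beta_n=\sum_{j=0}^{n}\frac{\alpha_j}{(q;q)_{n-j}(aq;q)_{n+j}}$ for all $n\ge0$. The function $K$: for complex $a,b,c,d,e,u,v$ and a base $p$, let $\sigma_1,\dots,\sigma_4$ be the elementary symmetric functions of $b,c,d,e$ and \[ K(a,b,c,d,e,u,v,p):=\frac{uv(\sigma_3-a\sigma_1)(p\sigma_3-a\sigma_1)a^2+(1-p)uv(a^2-\sigma_4)(a^2-\sigma_2a+\sigma_4)a+(u+v)(a+uv)(\sigma_3-a\sigma_1)(a^2-p\sigma_4)a+(u^2+a)(v^2+a)(a^2-\sigma_4)(a^2-p\sigma_4)}{(a^2-bcde)(a^2-bcde\,p)(1-u)(a-u)(1-v)(a-v)}. \] *)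

theory Defs
  imports Complex_Main
begin

definition qpoch :: "complex \<Rightarrow> complex \<Rightarrow> nat \<Rightarrow> complex" where
  "qpoch x q n = (\<Prod>k<n. 1 - x * q ^ k)"

definition qpochs :: "complex list \<Rightarrow> complex \<Rightarrow> nat \<Rightarrow> complex" where
  "qpochs xs q n = (\<Prod>x\<leftarrow>xs. qpoch x q n)"

definition bailey_pair ::
  "complex \<Rightarrow> complex \<Rightarrow> (nat \<Rightarrow> complex) \<Rightarrow> (nat \<Rightarrow> complex) \<Rightarrow> bool" where
  "bailey_pair a q \<alpha> \<beta> \<longleftrightarrow>
     \<alpha> 0 = 1 \<and>
     (\<forall>n. \<beta> n = (\<Sum>j\<le>n. \<alpha> j / (qpoch q q (n - j) * qpoch (a * q) q (n + j))))"

definition K_num ::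
  "complex \<Rightarrow> complex \<Rightarrow> complex \<Rightarrow> complex \<Rightarrow> complex \<Rightarrow> complex \<Rightarrow> complex \<Rightarrow> complex \<Rightarrow> complex" where
  "K_num a b c d e u v p =
     (let s1 = b + c + d + e;
          s2 = b * c + b * d + b * e + c * d + c * e + d * e;
          s3 = b * c * d + b * c * e + b * d * e + c * d * e;
          s4 = b * c * d * e
      in u * v * (s3 - a * s1) * (p * s3 - a * s1) * a\<^sup>2
         + (1 - p) * u * v * (a\<^sup>2 - s4) * (a\<^sup>2 - s2 * a + s4) * a
         + (u + v) * (a + u * v) * (s3 - a * s1) * (a\<^sup>2 - p * s4) * a
         + (u\<^sup>2 + a) * (v\<^sup>2 + a) * (a\<^sup>2 - s4) * (a\<^sup>2 - p * s4))"

definition K_den ::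
  "complex \<Rightarrow> complex \<Rightarrow> complex \<Rightarrow> complex \<Rightarrow> complex \<Rightarrow> complex \<Rightarrow> complex \<Rightarrow> complex \<Rightarrow> complex" where
  "K_den a b c d e u v p =
     (a\<^sup>2 - b * c * d * e) * (a\<^sup>2 - b * c * d * e * p) * (1 - u) * (a - u) * (1 - v) * (a - v)"

definition K_fun ::
  "complex \<Rightarrow> complex \<Rightarrow> complex \<Rightarrow> complex \<Rightarrow> complex \<Rightarrow> complex \<Rightarrow> complex \<Rightarrow> complex \<Rightarrow> complex" where
  "K_fun a b c d e u v p = K_num a b c d e u v p / K_den a b c d e u v p"

definition K0 :: "complex \<Rightarrow> complex \<Rightarrow> complex \<Rightarrow> complex \<Rightarrow> nat \<Rightarrow> complex" where
  "K0 a u v q n =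
     K_fun a (q powi (- int n)) (q powi (1 - int n)) (q powi (2 - int n)) a u v (q ^ 3)"

definition K0' :: "complex \<Rightarrow> complex \<Rightarrow> complex \<Rightarrow> complex \<Rightarrow> nat \<Rightarrow> complex" where
  "K0' a u v q n =
     K_fun (a * q) (q powi (- int n)) (q powi (1 - int n)) (q powi (2 - int n)) (a * q) u v (q ^ 3)"

definition A_coeff :: "complex \<Rightarrow> complex \<Rightarrow> complex \<Rightarrow> complex \<Rightarrow> nat \<Rightarrow> complex" where
  "A_coeff a u v q r =
     qpochs [a * q, q ^ 3 * u, q ^ 3 * v, a * q ^ 4 / u, a * q ^ 4 / v] (q ^ 3) r /
     qpochs [u, v, a * q / u, a * q / v, q ^ 3] (q ^ 3) r"

(* Every integer division by 2 in the exponents below is exact. *)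

definition alpha1 :: "complex \<Rightarrow> complex \<Rightarrow> complex \<Rightarrow> complex \<Rightarrow> nat \<Rightarrow> complex" where
  "alpha1 a u v q n =
     (let r = n div 3 in
      if n mod 3 = 0 then
        (1 - a * q ^ (6 * r)) / (1 - a) *
        (qpochs [a, q ^ 3 * u, q ^ 3 * v, a * q ^ 3 / u, a * q ^ 3 / v] (q ^ 3) r /
         qpochs [u, v, a / u, a / v, q ^ 3] (q ^ 3) r) *
        q powi ((9 * (int r)\<^sup>2 - 15 * int r) div 2) * (- a) ^ r
      else 0)"

definition beta1 :: "complex \<Rightarrow> complex \<Rightarrow> complex \<Rightarrow> complex \<Rightarrow> nat \<Rightarrow> complex" where
  "beta1 a u v q n = K0 a u v q n * (qpoch a (q ^ 3) n / (qpoch a q (2 * n) * qpoch q q n))"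

definition alpha2 :: "complex \<Rightarrow> complex \<Rightarrow> complex \<Rightarrow> complex \<Rightarrow> nat \<Rightarrow> complex" where
  "alpha2 a u v q n =
     (let r = n div 3 in
      if n mod 3 = 0 then
        A_coeff a u v q r * q powi ((9 * (int r)\<^sup>2 - 13 * int r) div 2) * (- a) ^ r
      else if n mod 3 = 1 then
        A_coeff a u v q r * q powi ((9 * (int r)\<^sup>2 - int r) div 2 + 1) * (- a) ^ (r + 1)
      else 0)"

definition beta2 :: "complex \<Rightarrow> complex \<Rightarrow> complex \<Rightarrow> complex \<Rightarrow> nat \<Rightarrow> complex" where
  "beta2 a u v q n =
     K0' a u v q n * (qpoch (a * q) (q ^ 3) n / (qpoch (a * q) q (2 * n) * qpoch q q n))"

definition alpha3 :: "complex \<Rightarrow> complex \<Rightarrow> complex \<Rightarrow> complex \<Rightarrow> nat \<Rightarrow> complex" where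
  "alpha3 a u v q n =
     (let r = n div 3 in
      if n mod 3 = 0 then
        A_coeff a u v q r * q powi ((9 * (int r)\<^sup>2 - 7 * int r) div 2) * (- a) ^ r
      else if n mod 3 = 1 then
        - A_coeff a u v q r * q powi ((9 * (int r)\<^sup>2 - 7 * int r) div 2) * (- a) ^ r
      else 0)"

definition beta3 :: "complex \<Rightarrow> complex \<Rightarrow> complex \<Rightarrow> complex \<Rightarrow> nat \<Rightarrow> complex" where
  "beta3 a u v q n =
     K0' a u v q n *
     (qpoch (a * q) (q ^ 3) n * q ^ n / (qpoch (a * q) q (2 * n) * qpoch q q n))"

(* Genericity: the denominators occurring in the sequences and in the Bailey relation do not
   vanish.  The non-vanishing of q, u and v accounts for the negative powers of q and for the
   quotients by u and v; for a, it is implied by K_den not vanishing. *)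

definition generic_common :: "complex \<Rightarrow> complex \<Rightarrow> complex \<Rightarrow> complex \<Rightarrow> bool" where
  "generic_common a u v q \<longleftrightarrow>
     q \<noteq> 0 \<and> u \<noteq> 0 \<and> v \<noteq> 0 \<and>
     (\<forall>n. qpoch q q n \<noteq> 0) \<and> (\<forall>n. qpoch (a * q) q n \<noteq> 0)"

definition generic1 :: "complex \<Rightarrow> complex \<Rightarrow> complex \<Rightarrow> complex \<Rightarrow> bool" where
  "generic1 a u v q \<longleftrightarrow>
     generic_common a u v q \<and>
     1 - a \<noteq> 0 \<and>
     (\<forall>r. qpochs [u, v, a / u, a / v, q ^ 3] (q ^ 3) r \<noteq> 0) \<and>
     (\<forall>n. qpoch a q (2 * n) \<noteq> 0) \<and>
     (\<forall>n. K_den a (q powi (- int n)) (q powi (1 - int n)) (q powi (2 - int n)) a u v (q ^ 3) \<noteq> 0)"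

definition generic2 :: "complex \<Rightarrow> complex \<Rightarrow> complex \<Rightarrow> complex \<Rightarrow> bool" where
  "generic2 a u v q \<longleftrightarrow>
     generic_common a u v q \<and>
     (\<forall>r. qpochs [u, v, a * q / u, a * q / v, q ^ 3] (q ^ 3) r \<noteq> 0) \<and>
     (\<forall>n. K_den (a * q) (q powi (- int n)) (q powi (1 - int n)) (q powi (2 - int n)) (a * q)
            u v (q ^ 3) \<noteq> 0)"

end

theory Submission
  imports Defs
begin

text \<open>
  Let \<open>W(b,c,d)\<close> be the weights of the terminating very-well-poised 6-phi-5 series with parameters
  \<open>a; b, c, d\<close> in base \<open>p\<close>, put \<open>Q = p^r\<close>, and let \<open>z = 1/Q + a Q\<close> be the node of the \<open>r\<close>-th term. The
  factors that contain \<open>u\<close> combine to \<open>(1 - u Q) (1 - a Q / u) = Q (z - (u + a/u))\<close>, and likewise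
  for \<open>v\<close>, so inserting both pairs multiplies the sum by the mean of a quadratic polynomial in \<open>z\<close>;
  \<open>K\<close> with \<open>e = a\<close> is this mean, up to normalization. The first moment of \<open>z\<close> is found by
  telescoping. The second follows from the first, because \<open>(z - (b + a/b)) W(b,c,d)\<close> is a multiple
  of \<open>W(b p,c,d)\<close>.

  For \<open>p = q^3\<close> and \<open>(b,c,d) = (q^-n, q^(1-n), q^(2-n))\<close> the weights become the Bailey kernel, and
  replacing \<open>b\<close> by \<open>b p\<close> lowers \<open>n\<close> by one, which evaluates the 6-phi-5 sum by induction. This
  proves (i). In (ii) and (iii) the terms with indices \<open>3r\<close> and \<open>3r + 1\<close> add up to the \<open>r\<close>-th term of
  (i) with \<open>a q\<close> in place of \<open>a\<close>.
\<close>

subsection \<open>Finite q-Pochhammer products\<close>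

lemma qpoch_0 [simp]: "qpoch x q 0 = 1"
  by (simp add: qpoch_def)

lemma qpoch_Suc: "qpoch x q (Suc n) = qpoch x q n * (1 - x * q ^ n)"
  by (simp add: qpoch_def)

lemma qpoch_Suc_left: "qpoch x q (Suc n) = (1 - x) * qpoch (x * q) q n"
  by (induction n) (simp_all add: qpoch_Suc mult.assoc)

lemma qpoch_mult_base: "(1 - x) * qpoch (x * q) q n = qpoch x q n * (1 - x * q ^ n)"
  by (metis qpoch_Suc qpoch_Suc_left)

lemma qpoch_eq_0_iff: "qpoch x q n = 0 \<longleftrightarrow> (\<exists>k<n. x * q ^ k = 1)"
  by (auto simp: qpoch_def)

lemma qpoch_add: "qpoch x q (m + n) = qpoch x q m * qpoch (x * q ^ m) q n"
  by (induction n) (simp_all add: qpoch_Suc power_add mult.assoc)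

lemma qpoch_mult_3:
  "qpoch x q (3 * r) = qpoch x (q ^ 3) r * qpoch (x * q) (q ^ 3) r * qpoch (x * q\<^sup>2) (q ^ 3) r"
proof (induction r)
  case (Suc r)
  have "3 * Suc r = Suc (Suc (Suc (3 * r)))" by simp
  also have "qpoch x q \<dots>
      = qpoch x q (3 * r)
        * ((1 - x * (q ^ 3) ^ r) * (1 - x * q * (q ^ 3) ^ r) * (1 - x * q\<^sup>2 * (q ^ 3) ^ r))"
    by (simp add: qpoch_Suc power_mult power2_eq_square mult.assoc)
  finally have "qpoch x q (3 * Suc r) = \<dots>" .
  with Suc show ?case
    by (simp add: qpoch_Suc mult_ac)
qed simp

lemma Suc_choose_two: "Suc n choose 2 = (n choose 2) + n"
  by (simp add: numeral_2_eq_2)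

lemma qpoch_inverse_power:
  assumes "q \<noteq> 0" "k \<le> n"
  shows "qpoch (1 / q ^ n) q k * q ^ (n * k) * qpoch q q (n - k)
       = (- 1) ^ k * q ^ (k choose 2) * qpoch q q n"
  using assms(2)
proof (induction k)
  case (Suc k)
  then have n_minus_k: "n - k = Suc (n - Suc k)" by simp
  have "q ^ n = q ^ k * q ^ (n - k)" using Suc.prems by (simp flip: power_add)
  then have factor: "(1 - 1 / q ^ n * q ^ k) * q ^ n = - (q ^ k * (1 - q ^ (n - k)))"
    using assms(1) by (simp add: field_simps)
  have "qpoch (1 / q ^ n) q (Suc k) * q ^ (n * Suc k) * qpoch q q (n - Suc k)
      = qpoch (1 / q ^ n) q k * q ^ (n * k) * qpoch q q (n - Suc k)
        * ((1 - 1 / q ^ n * q ^ k) * q ^ n)"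
    by (simp add: qpoch_Suc power_add mult_ac)
  also have "\<dots> = - (q ^ k)
      * (qpoch (1 / q ^ n) q k * q ^ (n * k) * (qpoch q q (n - Suc k) * (1 - q ^ (n - k))))"
    unfolding factor by (simp only: mult_ac mult_minus_left mult_minus_right)
  also have "qpoch q q (n - Suc k) * (1 - q ^ (n - k)) = qpoch q q (n - k)"
    unfolding n_minus_k by (simp add: qpoch_Suc)
  also have "- (q ^ k) * (qpoch (1 / q ^ n) q k * q ^ (n * k) * qpoch q q (n - k))
      = (- 1) ^ Suc k * q ^ (Suc k choose 2) * qpoch q q n"
    using Suc by (simp add: Suc_choose_two power_add mult_ac)
  finally show ?case .
qed (simp add: numeral_2_eq_2)

subsection \<open>Moments of very-well-poised sums\<close>

definition node :: "complex \<Rightarrow> complex \<Rightarrow> nat \<Rightarrow> complex" where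
  "node a p r = 1 / p ^ r + a * p ^ r"

lemma node_factorization:
  assumes "p \<noteq> 0" "x \<noteq> 0"
  shows "(1 - x * p ^ r) * (1 - a / x * p ^ r) = p ^ r * (node a p r - (x + a / x))"
  using assms by (simp add: node_def field_simps)

definition uv_factor ::
  "complex \<Rightarrow> complex \<Rightarrow> complex \<Rightarrow> complex \<Rightarrow> nat \<Rightarrow> complex" where
  "uv_factor a u v p r =
     qpochs [p * u, p * v, a * p / u, a * p / v] p r / qpochs [u, v, a / u, a / v] p r
       / p ^ (2 * r)"

lemma qpoch_pair_ratio:
  assumes "p \<noteq> 0" "x \<noteq> 0" "qpoch x p r \<noteq> 0" "qpoch (a / x) p r \<noteq> 0"
  shows "qpoch (p * x) p r * qpoch (a * p / x) p r / (qpoch x p r * qpoch (a / x) p r) / p ^ r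
         * ((1 - x) * (1 - a / x)) = node a p r - (x + a / x)"
proof -
  have "(1 - x) * qpoch (p * x) p r = qpoch x p r * (1 - x * p ^ r)"
    "(1 - a / x) * qpoch (a * p / x) p r = qpoch (a / x) p r * (1 - a / x * p ^ r)"
    using qpoch_mult_base[of x p r] qpoch_mult_base[of "a / x" p r] by (simp_all add: mult.commute)
  then have "((1 - x) * qpoch (p * x) p r) * ((1 - a / x) * qpoch (a * p / x) p r)
      = qpoch x p r * qpoch (a / x) p r * (p ^ r * (node a p r - (x + a / x)))"
    unfolding node_factorization[OF assms(1,2), symmetric] by (simp only: mult_ac)
  then show ?thesis
    using assms by (simp add: mult_ac)
qed

lemma uv_factor_eq:
  assumes nonzero: "p \<noteq> 0" "u \<noteq> 0" "v \<noteq> 0"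
    and den: "qpochs [u, v, a / u, a / v] p r \<noteq> 0"
  shows "uv_factor a u v p r * ((1 - u) * (1 - a / u) * (1 - v) * (1 - a / v))
       = (node a p r - (u + a / u)) * (node a p r - (v + a / v))"
proof -
  have "qpoch x p r \<noteq> 0" "qpoch (a / x) p r \<noteq> 0" if "x \<in> {u, v}" for x
    using den that by (auto simp: qpochs_def)
  moreover have "p ^ (2 * r) = p ^ r * p ^ r"
    by (simp add: mult_2 power_add)
  ultimately show ?thesis
    using nonzero by (simp add: qpoch_pair_ratio[symmetric] uv_factor_def qpochs_def mult_ac)
qed

definition wp_coeff ::
  "complex \<Rightarrow> complex \<Rightarrow> complex \<Rightarrow> complex \<Rightarrow> complex \<Rightarrow> nat \<Rightarrow> complex" where
  "wp_coeff a b c d p r =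
     qpochs [a, b, c, d] p r / qpochs [p, a * p / b, a * p / c, a * p / d] p r
       * (a * p / (b * c * d)) ^ r"

definition vwp_weight ::
  "complex \<Rightarrow> complex \<Rightarrow> complex \<Rightarrow> complex \<Rightarrow> complex \<Rightarrow> nat \<Rightarrow> complex" where
  "vwp_weight a b c d p r = (1 - a * p ^ (2 * r)) / (1 - a) * wp_coeff a b c d p r"

definition vwp_antidifference ::
  "complex \<Rightarrow> complex \<Rightarrow> complex \<Rightarrow> complex \<Rightarrow> complex \<Rightarrow> nat \<Rightarrow> complex" where
  "vwp_antidifference a b c d p r =
     wp_coeff a b c d p r / (1 - a)
       * ((1 - p ^ r) * (b - a * p ^ r) * (c - a * p ^ r) * (d - a * p ^ r)) / p ^ r"

definition vwp_moment ::
  "complex \<Rightarrow> complex \<Rightarrow> complex \<Rightarrow> complex \<Rightarrow> complex \<Rightarrow> nat \<Rightarrow> nat \<Rightarrow> complex" where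
  "vwp_moment a b c d p m k = (\<Sum>r\<le>m. vwp_weight a b c d p r * node a p r ^ k)"

text \<open>
  The first two moments of the node have these numerators over the denominators \<open>a - b c d\<close> and
  \<open>(a - b c d) (a - p b c d)\<close>. The \<open>s\<^sub>i\<close> are those of \<open>K_num\<close> for \<open>e = a\<close>.
\<close>

definition mean_numerator :: "complex \<Rightarrow> complex \<Rightarrow> complex \<Rightarrow> complex \<Rightarrow> complex" where
  "mean_numerator a b c d = a * (b + c + d + a) - (b * c * d + b * c * a + b * d * a + c * d * a)"

definition mean_square_numerator ::
  "complex \<Rightarrow> complex \<Rightarrow> complex \<Rightarrow> complex \<Rightarrow> complex \<Rightarrow> complex" where
  "mean_square_numerator a b c d p =
     (let s1 = b + c + d + a;
          s2 = b * c + b * d + b * a + c * d + c * a + d * a;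
          s3 = b * c * d + b * c * a + b * d * a + c * d * a;
          s4 = b * c * d * a
      in (s3 - a * s1) * (p * s3 - a * s1) + (1 - p) * (a - b * c * d) * (a\<^sup>2 - s2 * a + s4))"

lemma K_num_eq:
  fixes a b c d u v p :: complex
  assumes "u \<noteq> 0" "v \<noteq> 0"
  defines "x \<equiv> u + a / u" and "y \<equiv> v + a / v"
  shows "K_num a b c d a u v p = a\<^sup>2 * (u * v)
           * (mean_square_numerator a b c d p
              - (x + y) * mean_numerator a b c d * (a - p * (b * c * d))
              + x * y * (a - b * c * d) * (a - p * (b * c * d)))"
proof -
  define s1 s2 s3 s4 where "s1 = b + c + d + a"
    and "s2 = b * c + b * d + b * a + c * d + c * a + d * a"
    and "s3 = b * c * d + b * c * a + b * d * a + c * d * a"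
    and "s4 = b * c * d * a"
  have factors: "a\<^sup>2 - s4 = a * (a - b * c * d)" "a\<^sup>2 - p * s4 = a * (a - p * (b * c * d))"
    by (simp_all add: s4_def power2_eq_square algebra_simps)
  have uv: "u\<^sup>2 + a = u * x" "v\<^sup>2 + a = v * y" "(u + v) * (a + u * v) = u * v * (x + y)"
    using assms(1,2) by (simp_all add: x_def y_def field_simps power2_eq_square)
  have "K_num a b c d a u v p
      = u * v * (s3 - a * s1) * (p * s3 - a * s1) * a\<^sup>2
        + (1 - p) * u * v * (a\<^sup>2 - s4) * (a\<^sup>2 - s2 * a + s4) * a
        + (u + v) * (a + u * v) * (s3 - a * s1) * (a\<^sup>2 - p * s4) * a
        + (u\<^sup>2 + a) * (v\<^sup>2 + a) * (a\<^sup>2 - s4) * (a\<^sup>2 - p * s4)"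
    unfolding K_num_def Let_def s1_def s2_def s3_def s4_def ..
  moreover have "mean_square_numerator a b c d p
      = (s3 - a * s1) * (p * s3 - a * s1) + (1 - p) * (a - b * c * d) * (a\<^sup>2 - s2 * a + s4)"
    "mean_numerator a b c d = a * s1 - s3"
    unfolding mean_square_numerator_def mean_numerator_def Let_def s1_def s2_def s3_def s4_def
    by (rule refl)+
  ultimately show ?thesis
    unfolding factors uv by algebra
qed

lemma K_den_eq:
  assumes "u \<noteq> 0" "v \<noteq> 0"
  shows "K_den a b c d a u v p = a\<^sup>2 * (u * v) * (a - b * c * d) * (a - p * (b * c * d))
           * ((1 - u) * (1 - a / u) * (1 - v) * (1 - a / v))"
proof -
  have "a - u = - u * (1 - a / u)" "a - v = - v * (1 - a / v)"
    using assms by (simp_all add: field_simps)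
  moreover have "a\<^sup>2 - b * c * d * a = a * (a - b * c * d)"
    "a\<^sup>2 - b * c * d * a * p = a * (a - p * (b * c * d))"
    by (simp_all add: power2_eq_square algebra_simps)
  ultimately show ?thesis
    by (simp add: K_den_def power2_eq_square mult_ac)
qed

lemma vwp_weight_rotate: "vwp_weight a b c d p r = vwp_weight a c d b p r"
  by (simp add: vwp_weight_def wp_coeff_def qpochs_def mult_ac)

lemma vwp_moment_rotate: "vwp_moment a b c d p m k = vwp_moment a c d b p m k"
  unfolding vwp_moment_def vwp_weight_rotate[of a b c d] ..

locale well_poised =
  fixes a b c d p :: complex
  assumes nonzero: "p \<noteq> 0" "b \<noteq> 0" "c \<noteq> 0" "d \<noteq> 0"
    and denominator_nonzero: "qpochs [p, a * p / b, a * p / c, a * p / d] p r \<noteq> 0"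
begin

lemma wp_coeff_Suc:
  defines "t \<equiv> \<lambda>r. wp_coeff a b c d p r"
  fixes r defines "Q \<equiv> p ^ r"
  shows "t (Suc r) * ((1 - p * Q) * (b - a * (p * Q)) * (c - a * (p * Q)) * (d - a * (p * Q)))
       = t r * (a * p * (1 - a * Q) * (1 - b * Q) * (1 - c * Q) * (1 - d * Q))"
proof -
  define N where "N = (1 - a * Q) * (1 - b * Q) * (1 - c * Q) * (1 - d * Q)"
  define D where "D = (1 - p * Q) * (1 - a * p / b * Q) * (1 - a * p / c * Q) * (1 - a * p / d * Q)"
  have "D \<noteq> 0"
    using denominator_nonzero[of "Suc r"] by (simp add: D_def Q_def qpochs_def qpoch_Suc)
  have "t (Suc r) * (b * c * d * D) = t r * (N / D) * (a * p / (b * c * d)) * (b * c * d * D)"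
    by (simp add: t_def wp_coeff_def qpochs_def qpoch_Suc N_def D_def Q_def mult_ac)
  also have "\<dots> = t r * (a * p * N)"
    using \<open>D \<noteq> 0\<close> nonzero by simp
  finally have "t (Suc r) * (b * c * d * D) = t r * (a * p * N)" .
  moreover have "x * (1 - a * p / x * Q) = x - a * (p * Q)" if "x \<noteq> 0" for x
    using that by (simp add: right_diff_distrib)
  then have "(1 - p * Q) * (b - a * (p * Q)) * (c - a * (p * Q)) * (d - a * (p * Q))
      = (1 - p * Q) * (b * (1 - a * p / b * Q)) * (c * (1 - a * p / c * Q))
        * (d * (1 - a * p / d * Q))"
    using nonzero by (simp only: not_False_eq_True)
  then have "(1 - p * Q) * (b - a * (p * Q)) * (c - a * (p * Q)) * (d - a * (p * Q)) = b * c * d * D"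
    by (simp only: D_def mult_ac)
  ultimately show ?thesis
    by (simp only: N_def mult.assoc)
qed

lemma vwp_weight_telescopes:
  "vwp_weight a b c d p r * ((a - b * c * d) * node a p r - mean_numerator a b c d)
     = vwp_antidifference a b c d p (Suc r) - vwp_antidifference a b c d p r"
proof -
  let ?H = "vwp_antidifference a b c d p" and ?\<mu> = "mean_numerator a b c d"
  define Q where "Q = p ^ r"
  have "Q \<noteq> 0" using nonzero by (simp add: Q_def)
  define t where "t = wp_coeff a b c d p r / (1 - a)"
  have "?H (Suc r) = t * (a * ((1 - a * Q) * (1 - b * Q) * (1 - c * Q) * (1 - d * Q))) / Q"
    using wp_coeff_Suc[of r] nonzero by (simp add: vwp_antidifference_def t_def Q_def mult_ac)
  then have "?H (Suc r) - ?H r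
      = t * (a * ((1 - a * Q) * (1 - b * Q) * (1 - c * Q) * (1 - d * Q))
          - (1 - Q) * (b - a * Q) * (c - a * Q) * (d - a * Q)) / Q"
    by (simp add: vwp_antidifference_def t_def Q_def right_diff_distrib diff_divide_distrib)
  also have "a * ((1 - a * Q) * (1 - b * Q) * (1 - c * Q) * (1 - d * Q))
        - (1 - Q) * (b - a * Q) * (c - a * Q) * (d - a * Q)
      = (1 - a * Q\<^sup>2) * ((a - b * c * d) * (1 + a * Q\<^sup>2) - ?\<mu> * Q)"
    unfolding mean_numerator_def by algebra
  also have "1 + a * Q\<^sup>2 = node a p r * Q"
    using \<open>Q \<noteq> 0\<close> by (simp add: node_def Q_def field_simps power2_eq_square)
  also have "(a - b * c * d) * (node a p r * Q) - ?\<mu> * Q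
      = ((a - b * c * d) * node a p r - ?\<mu>) * Q"
    by algebra
  also have "t * ((1 - a * Q\<^sup>2) * (((a - b * c * d) * node a p r - ?\<mu>) * Q)) / Q
      = t * (1 - a * Q\<^sup>2) * ((a - b * c * d) * node a p r - ?\<mu>)"
    using \<open>Q \<noteq> 0\<close> by simp
  also have "t * (1 - a * Q\<^sup>2) = vwp_weight a b c d p r"
    by (simp add: vwp_weight_def t_def Q_def power_even_eq)
  finally show ?thesis ..
qed

lemma first_vwp_moment:
  assumes "qpochs [b, c, d] p (Suc m) = 0"
  shows "(a - b * c * d) * vwp_moment a b c d p m 1
       = mean_numerator a b c d * vwp_moment a b c d p m 0"
proof -
  let ?H = "vwp_antidifference a b c d p"
  have "(a - b * c * d) * vwp_moment a b c d p m 1 - mean_numerator a b c d * vwp_moment a b c d p m 0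
      = (\<Sum>r\<le>m. vwp_weight a b c d p r * ((a - b * c * d) * node a p r - mean_numerator a b c d))"
    unfolding vwp_moment_def sum_distrib_left sum_subtractf[symmetric]
    by (intro sum.cong refl) (simp add: algebra_simps)
  also have "\<dots> = (\<Sum>r<Suc m. ?H (Suc r) - ?H r)"
    unfolding vwp_weight_telescopes lessThan_Suc_atMost ..
  also have "\<dots> = ?H (Suc m) - ?H 0"
    by (rule sum_lessThan_telescope)
  also have "\<dots> = 0"
    using assms by (auto simp: vwp_antidifference_def wp_coeff_def qpochs_def)
  finally show ?thesis by simp
qed

lemma well_poised_shift:
  assumes "a \<noteq> b"
  shows "well_poised a (b * p) c d p"
proof
  fix r
  have "qpoch (a / b) p (Suc r) \<noteq> 0"
    using assms nonzero denominator_nonzero[of r] by (simp add: qpoch_Suc_left qpochs_def)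
  then have "qpoch (a / b) p r \<noteq> 0" by (simp add: qpoch_Suc)
  then show "qpochs [p, a * p / (b * p), a * p / c, a * p / d] p r \<noteq> 0"
    using nonzero denominator_nonzero[of r] by (simp add: qpochs_def)
qed (use nonzero in auto)

lemma wp_coeff_shift:
  assumes "a \<noteq> b"
  shows "(1 - b) * (1 - a / b) * wp_coeff a (b * p) c d p r
       = (node a p r - (b + a / b)) * wp_coeff a b c d p r"
proof -
  interpret shifted: well_poised a "b * p" c d p
    using assms by (rule well_poised_shift)
  define Q x where "Q = p ^ r" and "x = a / b"
  have "Q \<noteq> 0" using nonzero by (simp add: Q_def)
  have "1 - x \<noteq> 0" "qpoch x p r \<noteq> 0" "qpoch (x * p) p r \<noteq> 0"
    using assms nonzero denominator_nonzero[of r] shifted.denominator_nonzero[of r]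
    by (simp_all add: x_def qpochs_def)
  then have ratio: "(1 - x) / qpoch x p r = (1 - x * Q) / qpoch (x * p) p r"
    using qpoch_mult_base[of x p r] by (simp add: Q_def frac_eq_eq mult_ac)
  define w where "w = qpochs [a, c, d] p r / qpochs [p, a * p / c, a * p / d] p r
      * (a * p / (b * c * d)) ^ r"
  have "(1 - b) * (1 - x) * wp_coeff a (b * p) c d p r
      = w / Q * ((1 - b) * qpoch (b * p) p r) * ((1 - x) / qpoch x p r)"
    using nonzero
    by (simp add: wp_coeff_def qpochs_def w_def x_def Q_def power_divide power_mult_distrib mult_ac)
  also have "\<dots> = w / Q * (qpoch b p r / qpoch (x * p) p r) * ((1 - b * Q) * (1 - a / b * Q))"
    unfolding ratio qpoch_mult_base by (simp add: x_def Q_def)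
  also have "\<dots> = (node a p r - (b + a / b)) * (w * (qpoch b p r / qpoch (x * p) p r))"
    unfolding Q_def node_factorization[OF nonzero(1,2)] using nonzero by simp
  also have "w * (qpoch b p r / qpoch (x * p) p r) = wp_coeff a b c d p r"
    by (simp add: wp_coeff_def qpochs_def w_def x_def mult_ac)
  finally show ?thesis unfolding x_def .
qed

lemma vwp_weight_shift:
  assumes "a \<noteq> b"
  shows "(1 - b) * (b - a) * vwp_weight a (b * p) c d p r
       = (b * node a p r - (b\<^sup>2 + a)) * vwp_weight a b c d p r"
proof -
  define s where "s = (1 - a * p ^ (2 * r)) / (1 - a)"
  have "b - a = b * (1 - a / b)" "b * node a p r - (b\<^sup>2 + a) = b * (node a p r - (b + a / b))"
    using nonzero by (simp_all add: right_diff_distrib distrib_left power2_eq_square)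
  then have "(1 - b) * (b - a) * vwp_weight a (b * p) c d p r
      = s * b * ((1 - b) * (1 - a / b) * wp_coeff a (b * p) c d p r)"
    by (simp only: vwp_weight_def s_def mult_ac)
  also have "\<dots> = b * (node a p r - (b + a / b)) * vwp_weight a b c d p r"
    unfolding wp_coeff_shift[OF assms] by (simp only: vwp_weight_def s_def mult_ac)
  finally show ?thesis
    using \<open>b * node a p r - (b\<^sup>2 + a) = b * (node a p r - (b + a / b))\<close> by simp
qed

lemma vwp_moment_shift:
  assumes "a \<noteq> b"
  shows "(1 - b) * (b - a) * vwp_moment a (b * p) c d p m k
       = b * vwp_moment a b c d p m (Suc k) - (b\<^sup>2 + a) * vwp_moment a b c d p m k"
proof -
  have "(1 - b) * (b - a) * vwp_moment a (b * p) c d p m k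
      = (\<Sum>r\<le>m. (1 - b) * (b - a) * vwp_weight a (b * p) c d p r * node a p r ^ k)"
    by (simp add: vwp_moment_def sum_distrib_left mult.assoc)
  also have "\<dots>
      = (\<Sum>r\<le>m. (b * node a p r - (b\<^sup>2 + a)) * vwp_weight a b c d p r * node a p r ^ k)"
    unfolding vwp_weight_shift[OF assms] ..
  also have "\<dots> = b * vwp_moment a b c d p m (Suc k) - (b\<^sup>2 + a) * vwp_moment a b c d p m k"
    unfolding vwp_moment_def sum_distrib_left sum_subtractf[symmetric]
    by (intro sum.cong refl) (simp add: algebra_simps)
  finally show ?thesis .
qed

lemma contiguous_vwp_sums:
  assumes "a \<noteq> b" "b \<noteq> 1" "qpochs [b, c, d] p (Suc m) = 0"
  shows "(b - a) * (b * c * d - a) * vwp_moment a (b * p) c d p m 0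
       = (b * c - a) * (b * d - a) * vwp_moment a b c d p m 0"
proof -
  let ?M = "vwp_moment a b c d p m" and ?M' = "vwp_moment a (b * p) c d p m"
  have "(1 - b) * ((b - a) * (b * c * d - a) * ?M' 0)
      = (b * c * d - a) * ((1 - b) * (b - a) * ?M' 0)"
    by (simp only: mult_ac)
  also have "\<dots> = - (b * ((a - b * c * d) * ?M 1) + (b\<^sup>2 + a) * (b * c * d - a) * ?M 0)"
    unfolding vwp_moment_shift[OF assms(1)] by (simp add: algebra_simps)
  also have "\<dots> = (1 - b) * ((b * c - a) * (b * d - a) * ?M 0)"
    unfolding first_vwp_moment[OF assms(3)] mean_numerator_def
    by (simp add: algebra_simps power2_eq_square)
  finally show ?thesis using assms(2) by simp
qed

lemma second_vwp_moment:
  assumes "a \<noteq> b" "qpochs [b, c, d] p (Suc m) = 0"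
  shows "(a - b * c * d) * (a - p * (b * c * d)) * vwp_moment a b c d p m 2
       = mean_square_numerator a b c d p * vwp_moment a b c d p m 0"
proof -
  interpret shifted: well_poised a "b * p" c d p
    using assms(1) by (rule well_poised_shift)
  let ?M = "vwp_moment a b c d p m" and ?M' = "vwp_moment a (b * p) c d p m"
  define \<mu> \<mu>' where "\<mu> = mean_numerator a b c d" and "\<mu>' = mean_numerator a (b * p) c d"
  have mean: "(a - b * c * d) * ?M 1 = \<mu> * ?M 0"
    unfolding \<mu>_def using assms(2) by (rule first_vwp_moment)
  have "b = 1 \<or> qpochs [b * p, c, d] p (Suc m) = 0"
    using assms(2) by (auto simp: qpochs_def qpoch_Suc_left[of b] qpoch_Suc[of "b * p"])
  then have "(1 - b) * ((a - b * p * c * d) * ?M' 1) = (1 - b) * (\<mu>' * ?M' 0)"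
    unfolding \<mu>'_def using shifted.first_vwp_moment[of m] by (elim disjE) simp_all
  then have "(a - b * p * c * d) * ((1 - b) * (b - a) * ?M' 1) = \<mu>' * ((1 - b) * (b - a) * ?M' 0)"
    by algebra
  then have shifted_mean:
    "(a - p * (b * c * d)) * (b * ?M 2 - (b\<^sup>2 + a) * ?M 1) = \<mu>' * (b * ?M 1 - (b\<^sup>2 + a) * ?M 0)"
    unfolding vwp_moment_shift[OF assms(1)] by (simp add: numeral_2_eq_2 mult_ac)
  have "b * ((a - b * c * d) * (a - p * (b * c * d)) * ?M 2)
      = (a - b * c * d) * ((a - p * (b * c * d)) * (b * ?M 2 - (b\<^sup>2 + a) * ?M 1))
        + (a - p * (b * c * d)) * (b\<^sup>2 + a) * ((a - b * c * d) * ?M 1)"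
    by (simp add: algebra_simps)
  also have "\<dots> = \<mu>' * (b * ((a - b * c * d) * ?M 1) - (b\<^sup>2 + a) * (a - b * c * d) * ?M 0)
        + (a - p * (b * c * d)) * (b\<^sup>2 + a) * ((a - b * c * d) * ?M 1)"
    unfolding shifted_mean by (simp add: algebra_simps)
  also have "\<dots> = (\<mu>' * (b * \<mu> - (b\<^sup>2 + a) * (a - b * c * d))
        + (a - p * (b * c * d)) * (b\<^sup>2 + a) * \<mu>) * ?M 0"
    unfolding mean by (simp add: algebra_simps)
  also have "\<mu>' * (b * \<mu> - (b\<^sup>2 + a) * (a - b * c * d))
        + (a - p * (b * c * d)) * (b\<^sup>2 + a) * \<mu>
      = b * mean_square_numerator a b c d p"
    unfolding \<mu>_def \<mu>'_def mean_numerator_def mean_square_numerator_def Let_def by algebra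
  finally show ?thesis by (simp only: mult.assoc mult_left_cancel[OF nonzero(2)])
qed

lemma K_fun_times_vwp_sum:
  assumes "a \<noteq> b" and terminating: "qpochs [b, c, d] p (Suc m) = 0"
    and uv: "u \<noteq> 0" "v \<noteq> 0" and den: "K_den a b c d a u v p \<noteq> 0"
  defines "x \<equiv> u + a / u" and "y \<equiv> v + a / v"
  shows "K_fun a b c d a u v p * vwp_moment a b c d p m 0
           * ((1 - u) * (1 - a / u) * (1 - v) * (1 - a / v))
       = vwp_moment a b c d p m 2 - (x + y) * vwp_moment a b c d p m 1
           + x * y * vwp_moment a b c d p m 0"
    (is "_ = ?T")
proof -
  let ?M = "vwp_moment a b c d p m"
  define C where "C = (1 - u) * (1 - a / u) * (1 - v) * (1 - a / v)"
  define e e' where "e = a - b * c * d" and "e' = a - p * (b * c * d)"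
  define \<mu> \<nu> where "\<mu> = mean_numerator a b c d" and "\<nu> = mean_square_numerator a b c d p"
  have mean: "\<mu> * ?M 0 = e * ?M 1"
    unfolding \<mu>_def e_def using terminating by (rule first_vwp_moment[symmetric])
  have mean_square: "\<nu> * ?M 0 = e * e' * ?M 2"
    unfolding \<nu>_def e_def e'_def using assms(1) terminating by (rule second_vwp_moment[symmetric])
  have K_den: "K_den a b c d a u v p = a\<^sup>2 * (u * v) * e * e' * C"
    unfolding e_def e'_def C_def using uv by (rule K_den_eq)
  have "K_num a b c d a u v p = a\<^sup>2 * (u * v) * (\<nu> - (x + y) * \<mu> * e' + x * y * e * e')"
    unfolding e_def e'_def \<mu>_def \<nu>_def x_def y_def using uv by (rule K_num_eq)
  also have "\<dots> * ?M 0
      = a\<^sup>2 * (u * v) * (\<nu> * ?M 0 - (x + y) * e' * (\<mu> * ?M 0) + x * y * e * e' * ?M 0)"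
    by (simp add: algebra_simps)
  also have "\<dots> = a\<^sup>2 * (u * v) * e * e' * ?T"
    unfolding mean mean_square by (simp add: algebra_simps)
  finally have K_num: "K_num a b c d a u v p * ?M 0 = a\<^sup>2 * (u * v) * e * e' * ?T" .
  have "K_fun a b c d a u v p * ?M 0 * C = K_num a b c d a u v p * ?M 0 / K_den a b c d a u v p * C"
    by (simp add: K_fun_def)
  also have "\<dots> = ?T"
    using den unfolding K_num K_den by simp
  finally show ?thesis unfolding C_def .
qed

lemma vwp_sum_with_uv_factor:
  assumes "a \<noteq> b" "qpochs [b, c, d] p (Suc m) = 0"
    and uv: "u \<noteq> 0" "v \<noteq> 0"
    and den: "\<And>r. qpochs [u, v, a / u, a / v] p r \<noteq> 0"
    and K_den: "K_den a b c d a u v p \<noteq> 0"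
  shows "(\<Sum>r\<le>m. vwp_weight a b c d p r * uv_factor a u v p r)
       = K_fun a b c d a u v p * (\<Sum>r\<le>m. vwp_weight a b c d p r)"
proof -
  define C where "C = (1 - u) * (1 - a / u) * (1 - v) * (1 - a / v)"
  have "C \<noteq> 0" using den[of 1] by (simp add: C_def qpochs_def qpoch_def)
  define x y where "x = u + a / u" and "y = v + a / v"
  have "(\<Sum>r\<le>m. vwp_weight a b c d p r * uv_factor a u v p r) * C
      = (\<Sum>r\<le>m. vwp_weight a b c d p r * ((node a p r - x) * (node a p r - y)))"
    unfolding sum_distrib_right mult.assoc
      uv_factor_eq[OF nonzero(1) uv den, folded C_def x_def y_def] ..
  also have "\<dots> = vwp_moment a b c d p m 2 - (x + y) * vwp_moment a b c d p m 1
      + x * y * vwp_moment a b c d p m 0"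
    unfolding vwp_moment_def sum_distrib_left sum_subtractf[symmetric] sum.distrib[symmetric]
    by (intro sum.cong refl) (simp add: algebra_simps power2_eq_square)
  also have "\<dots> = K_fun a b c d a u v p * vwp_moment a b c d p m 0 * C"
    unfolding C_def x_def y_def by (rule K_fun_times_vwp_sum[OF assms(1-4) K_den, symmetric])
  finally show ?thesis using \<open>C \<noteq> 0\<close> by (simp add: vwp_moment_def)
qed

end

subsection \<open>The parameters \<open>q^-n\<close>, \<open>q^(1-n)\<close>, \<open>q^(2-n)\<close> in base \<open>q^3\<close>\<close>

locale cubic_base =
  fixes a q :: complex
  assumes q_nonzero: "q \<noteq> 0"
    and q_power_neq_1: "q ^ Suc k \<noteq> 1"
    and a_q_power_neq_1: "a * q ^ k \<noteq> 1"
begin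

abbreviation cubic_weight :: "nat \<Rightarrow> nat \<Rightarrow> complex" where
  "cubic_weight n \<equiv> vwp_weight a (1 / q ^ n) (q / q ^ n) (q\<^sup>2 / q ^ n) (q ^ 3)"

lemma qpoch_q_nonzero: "qpoch q q n \<noteq> 0"
  using q_power_neq_1 by (auto simp: qpoch_eq_0_iff simp flip: power_Suc)

lemma qpoch_a_q_power_nonzero: "qpoch (a * q ^ k) q n \<noteq> 0"
  using a_q_power_neq_1 by (auto simp: qpoch_eq_0_iff mult.assoc simp flip: power_add)

lemma cubic_numerators_eq:
  "qpoch (1 / q ^ n) q (3 * r) = qpochs [1 / q ^ n, q / q ^ n, q\<^sup>2 / q ^ n] (q ^ 3) r"
  by (simp add: qpoch_mult_3 qpochs_def mult.assoc)

lemma cubic_denominators_eq: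
  "qpoch (a * q ^ Suc n) q (3 * r)
     = qpochs [a * q ^ 3 / (1 / q ^ n), a * q ^ 3 / (q / q ^ n), a * q ^ 3 / (q\<^sup>2 / q ^ n)]
         (q ^ 3) r"
proof -
  have "a * q ^ 3 / (1 / q ^ n) = a * q ^ Suc n * q\<^sup>2" "a * q ^ 3 / (q / q ^ n) = a * q ^ Suc n * q"
    "a * q ^ 3 / (q\<^sup>2 / q ^ n) = a * q ^ Suc n"
    using q_nonzero by (simp_all add: power2_eq_square power3_eq_cube)
  then show ?thesis
    by (simp only: qpoch_mult_3 qpochs_def list.map prod_list.Cons prod_list.Nil mult_1_right)
      (simp only: mult_ac)
qed

lemma cubic_numerators_terminate:
  "n < 3 * m \<Longrightarrow> qpochs [1 / q ^ n, q / q ^ n, q\<^sup>2 / q ^ n] (q ^ 3) m = 0"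
  unfolding cubic_numerators_eq[symmetric] qpoch_eq_0_iff using q_nonzero by auto

lemma qpoch_q_cube_nonzero: "qpoch (q ^ 3) (q ^ 3) r \<noteq> 0"
proof -
  have "q ^ 3 * (q ^ 3) ^ k \<noteq> 1" for k
  proof -
    have "3 + 3 * k = Suc (3 * k + 2)" by simp
    then show ?thesis
      unfolding power_mult[symmetric] power_add[symmetric]
      by (simp only: q_power_neq_1 not_False_eq_True)
  qed
  then show ?thesis by (simp add: qpoch_eq_0_iff)
qed

lemma well_poised_cubic: "well_poised a (1 / q ^ n) (q / q ^ n) (q\<^sup>2 / q ^ n) (q ^ 3)"
proof
  show "qpochs [q ^ 3, a * q ^ 3 / (1 / q ^ n), a * q ^ 3 / (q / q ^ n), a * q ^ 3 / (q\<^sup>2 / q ^ n)]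
      (q ^ 3) r \<noteq> 0" for r
    using qpoch_q_cube_nonzero[of r] qpoch_a_q_power_nonzero[of "Suc n" "3 * r"]
    unfolding cubic_denominators_eq by (simp add: qpochs_def)
qed (use q_nonzero in auto)

lemma cubic_weight_sums_contiguous:
  assumes "Suc n < 3 * Suc m"
  defines "b \<equiv> 1 / q ^ Suc n"
  shows "(b - a) * (q ^ 3 * b ^ 3 - a) * (\<Sum>r\<le>m. cubic_weight n r)
       = (q * b\<^sup>2 - a) * (q\<^sup>2 * b\<^sup>2 - a) * (\<Sum>r\<le>m. cubic_weight (Suc n) r)"
proof -
  interpret well_poised a b "q * b" "q\<^sup>2 * b" "q ^ 3"
    using well_poised_cubic[of "Suc n"] by (simp add: b_def)
  have "b * q ^ Suc n = 1" using q_nonzero by (simp add: b_def)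
  then have "a \<noteq> b" "b \<noteq> 1"
    using a_q_power_neq_1[of "Suc n"] q_power_neq_1[of n] by auto
  moreover have "qpochs [b, q * b, q\<^sup>2 * b] (q ^ 3) (Suc m) = 0"
    using cubic_numerators_terminate[OF assms(1)] by (simp add: b_def)
  ultimately have "(b - a) * (b * (q * b) * (q\<^sup>2 * b) - a)
        * vwp_moment a (b * q ^ 3) (q * b) (q\<^sup>2 * b) (q ^ 3) m 0
      = (b * (q * b) - a) * (b * (q\<^sup>2 * b) - a) * vwp_moment a b (q * b) (q\<^sup>2 * b) (q ^ 3) m 0"
    by (rule contiguous_vwp_sums)
  also have "vwp_moment a b (q * b) (q\<^sup>2 * b) (q ^ 3) m 0 = (\<Sum>r\<le>m. cubic_weight (Suc n) r)"
    by (simp add: vwp_moment_def b_def)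
  \<comment> \<open>\<open>b q^3 = q^(2-n)\<close>, so the shifted parameters are those for \<open>n\<close> up to order\<close>
  also have "vwp_moment a (b * q ^ 3) (q * b) (q\<^sup>2 * b) (q ^ 3) m 0 = (\<Sum>r\<le>m. cubic_weight n r)"
    using q_nonzero unfolding vwp_moment_rotate[of a "b * q ^ 3"]
    by (simp add: vwp_moment_def b_def power2_eq_square power3_eq_cube)
  finally show ?thesis
    by (simp add: power2_eq_square power3_eq_cube mult_ac)
qed

lemma cubic_weight_sum_recurrence:
  assumes "Suc n < 3 * Suc m"
  shows "(1 - a * q ^ Suc n) * (1 - a * q ^ (3 * n)) * (\<Sum>r\<le>m. cubic_weight n r)
       = (1 - a * q ^ Suc (2 * n)) * (1 - a * q ^ (2 * n)) * (\<Sum>r\<le>m. cubic_weight (Suc n) r)"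
proof -
  let ?S = "\<lambda>n. \<Sum>r\<le>m. cubic_weight n r"
  define N b where "N = q ^ Suc n" and "b = 1 / N"
  have b_times_N: "b * N = 1" using q_nonzero by (simp add: N_def b_def)
  have powers: "q ^ 3 - a * N ^ 3 = q ^ 3 * (1 - a * q ^ (3 * n))"
    "q - a * N\<^sup>2 = q * (1 - a * q ^ Suc (2 * n))" "q\<^sup>2 - a * N\<^sup>2 = q\<^sup>2 * (1 - a * q ^ (2 * n))"
    by (simp_all add: N_def power_mult_distrib power_mult[symmetric] mult.commute[of n]
        right_diff_distrib) (simp add: power2_eq_square)
  have "(b - a) * (q ^ 3 * b ^ 3 - a) * N ^ 4 = (1 - a * N) * (q ^ 3 - a * N ^ 3)"
    using b_times_N by algebra
  then have left: "(b - a) * (q ^ 3 * b ^ 3 - a) * N ^ 4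
      = q ^ 3 * ((1 - a * q ^ Suc n) * (1 - a * q ^ (3 * n)))"
    unfolding powers by (simp add: N_def)
  have "(q * b\<^sup>2 - a) * (q\<^sup>2 * b\<^sup>2 - a) * N ^ 4 = (q - a * N\<^sup>2) * (q\<^sup>2 - a * N\<^sup>2)"
    using b_times_N by algebra
  then have right: "(q * b\<^sup>2 - a) * (q\<^sup>2 * b\<^sup>2 - a) * N ^ 4
      = q ^ 3 * ((1 - a * q ^ Suc (2 * n)) * (1 - a * q ^ (2 * n)))"
    unfolding powers by (simp add: power2_eq_square power3_eq_cube)
  have "(b - a) * (q ^ 3 * b ^ 3 - a) * ?S n = (q * b\<^sup>2 - a) * (q\<^sup>2 * b\<^sup>2 - a) * ?S (Suc n)"
    unfolding b_def N_def using assms by (rule cubic_weight_sums_contiguous)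
  then have "(b - a) * (q ^ 3 * b ^ 3 - a) * N ^ 4 * ?S n
      = (q * b\<^sup>2 - a) * (q\<^sup>2 * b\<^sup>2 - a) * N ^ 4 * ?S (Suc n)"
    by algebra
  then show ?thesis
    using q_nonzero unfolding left right by (simp add: mult.assoc)
qed

lemma cubic_weight_sum:
  "n < 3 * Suc m \<Longrightarrow>
     (\<Sum>r\<le>m. cubic_weight n r) = qpoch (a * q) q n * qpoch a (q ^ 3) n / qpoch a q (2 * n)"
proof (induction n)
  case 0
  have "cubic_weight 0 r = (if r = 0 then 1 else 0)" for r
    using a_q_power_neq_1[of 0]
    by (cases r) (simp_all add: vwp_weight_def wp_coeff_def qpochs_def qpoch_Suc_left[of 1])
  then show ?case by simp
next
  case (Suc n)
  let ?S = "\<lambda>n. \<Sum>r\<le>m. cubic_weight n r"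
  have IH: "?S n = qpoch (a * q) q n * qpoch a (q ^ 3) n / qpoch a q (2 * n)"
    using Suc by simp
  have factor_nonzero: "1 - a * q ^ k \<noteq> 0" for k
    using a_q_power_neq_1 by simp
  have "?S (Suc n) = (1 - a * q ^ Suc n) * (1 - a * q ^ (3 * n)) * ?S n
      / ((1 - a * q ^ Suc (2 * n)) * (1 - a * q ^ (2 * n)))"
    unfolding cubic_weight_sum_recurrence[OF Suc.prems]
    using factor_nonzero[of "Suc (2 * n)"] factor_nonzero[of "2 * n"] by simp
  also have "\<dots> = qpoch (a * q) q (Suc n) * qpoch a (q ^ 3) (Suc n) / qpoch a q (2 * Suc n)"
    unfolding IH power_mult[of q 3 n] by (simp add: qpoch_Suc mult_ac)
  finally show ?case .
qed

lemma cubic_weight_eq: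
  assumes "3 * r \<le> n"
  shows "cubic_weight n r / (qpoch q q n * qpoch (a * q) q n)
       = (1 - a * q ^ (6 * r)) / (1 - a)
         * (qpoch a (q ^ 3) r / qpoch (q ^ 3) (q ^ 3) r * q ^ (3 * r choose 2) * (- a) ^ r)
         / (qpoch q q (n - 3 * r) * qpoch (a * q) q (n + 3 * r))"
proof -
  define B where "B = qpoch (1 / q ^ n) q (3 * r)"
  define D where "D = qpoch (a * q ^ Suc n) q (3 * r)"
  have arg: "a * q ^ 3 / (1 / q ^ n * (q / q ^ n) * (q\<^sup>2 / q ^ n)) = a * q ^ (3 * n)"
    using q_nonzero by (simp add: power_mult power_mult_distrib power2_eq_square power3_eq_cube mult_ac)
  have "cubic_weight n r = (1 - a * (q ^ 3) ^ (2 * r)) / (1 - a)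
      * (qpoch a (q ^ 3) r * B / (qpoch (q ^ 3) (q ^ 3) r * D) * (a * q ^ (3 * n)) ^ r)"
    unfolding vwp_weight_def wp_coeff_def arg B_def D_def
      cubic_numerators_eq cubic_denominators_eq
    by (simp add: qpochs_def)
  also have "(q ^ 3) ^ (2 * r) = q ^ (6 * r)"
    by (simp flip: power_mult)
  also have "(a * q ^ (3 * n)) ^ r = a ^ r * q ^ (n * (3 * r))"
    by (simp add: power_mult_distrib mult_ac flip: power_mult)
  finally have weight: "cubic_weight n r = (1 - a * q ^ (6 * r)) / (1 - a)
      * (qpoch a (q ^ 3) r / qpoch (q ^ 3) (q ^ 3) r) * a ^ r * (B * q ^ (n * (3 * r)) / D)"
    by (simp add: mult_ac)
  have "qpoch (a * q) q (n + 3 * r) = qpoch (a * q) q n * D"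
    by (simp add: qpoch_add D_def mult.assoc)
  moreover have "B * q ^ (n * (3 * r))
      = (- 1) ^ r * q ^ (3 * r choose 2) * qpoch q q n / qpoch q q (n - 3 * r)"
    using qpoch_inverse_power[OF q_nonzero assms] qpoch_q_nonzero
    by (simp add: B_def power_mult eq_divide_eq)
  ultimately show ?thesis
    unfolding weight using qpoch_q_nonzero[of n] qpoch_a_q_power_nonzero[of 1 n]
    by (simp add: power_minus[of a] mult_ac)
qed

end

subsection \<open>The Bailey pairs\<close>

text \<open>The exponent \<open>(3r choose 2) - 6r\<close> equals \<open>(9r^2 - 15r)/2\<close>.\<close>

definition cubic_coeff :: "complex \<Rightarrow> complex \<Rightarrow> complex \<Rightarrow> complex \<Rightarrow> nat \<Rightarrow> complex" where
  "cubic_coeff a u v q r =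
     qpochs [a, q ^ 3 * u, q ^ 3 * v, a * q ^ 3 / u, a * q ^ 3 / v] (q ^ 3) r
       / qpochs [u, v, a / u, a / v, q ^ 3] (q ^ 3) r
       * (q ^ (3 * r choose 2) / q ^ (6 * r)) * (- a) ^ r"

lemma two_times_choose_two: "2 * int (n choose 2) = int n * (int n - 1)"
  by (induction n) (simp_all add: Suc_choose_two algebra_simps numeral_2_eq_2)

lemma power_cubic_exponent:
  fixes q :: complex
  assumes "q \<noteq> 0"
  shows "q powi ((9 * (int r)\<^sup>2 - (3 + 2 * k) * int r) div 2)
       = q ^ (3 * r choose 2) / (q ^ r) powi k"
proof -
  have "9 * (int r)\<^sup>2 - (3 + 2 * k) * int r = 2 * (int (3 * r choose 2) - int r * k)"
    using two_times_choose_two[of "3 * r"] by (simp add: algebra_simps power2_eq_square)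
  then have "(9 * (int r)\<^sup>2 - (3 + 2 * k) * int r) div 2 = int (3 * r choose 2) - int r * k"
    by simp
  then show ?thesis
    using assms by (simp add: power_int_diff power_int_mult)
qed

lemma div_mod_3:
  "3 * r div 3 = r" "(3 * r + 1) div 3 = r" "(3 * r + 2) div 3 = r"
  "3 * r mod 3 = 0" "(3 * r + 1) mod 3 = 1" "(3 * r + 2) mod 3 = 2" for r :: nat
  by presburger+

lemma alpha1_residues:
  assumes "q \<noteq> 0"
  shows "alpha1 a u v q (3 * r) = (1 - a * q ^ (6 * r)) / (1 - a) * cubic_coeff a u v q r"
    and "alpha1 a u v q (3 * r + 1) = 0" "alpha1 a u v q (3 * r + 2) = 0"
proof -
  have "q powi ((9 * (int r)\<^sup>2 - 15 * int r) div 2) = q ^ (3 * r choose 2) / q ^ (6 * r)"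
    using power_cubic_exponent[OF assms, of r 6] by (simp add: power_mult[symmetric] mult.commute[of r])
  then show "alpha1 a u v q (3 * r) = (1 - a * q ^ (6 * r)) / (1 - a) * cubic_coeff a u v q r"
    "alpha1 a u v q (3 * r + 1) = 0" "alpha1 a u v q (3 * r + 2) = 0"
    unfolding alpha1_def Let_def div_mod_3 cubic_coeff_def by (simp_all add: mult_ac)
qed

lemma A_coeff_eq_cubic_coeff:
  assumes "q \<noteq> 0"
  shows "A_coeff a u v q r * q ^ (3 * r choose 2) * (- a) ^ r
       = q ^ (5 * r) * cubic_coeff (a * q) u v q r"
proof -
  have shift: "a * q * q ^ 3 = a * q ^ 4" by (simp add: eval_nat_numeral)
  have power: "q ^ (6 * r) = q ^ (5 * r) * q ^ r" by (simp flip: power_add)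
  have sign: "(- (a * q)) ^ r = (- a) ^ r * q ^ r" by (simp flip: power_mult_distrib)
  show ?thesis
    unfolding A_coeff_def cubic_coeff_def shift power sign using assms by simp
qed

lemma alpha2_residues:
  assumes "q \<noteq> 0"
  shows "alpha2 a u v q (3 * r) = cubic_coeff (a * q) u v q r"
    and "alpha2 a u v q (3 * r + 1) = - (a * q * q ^ (6 * r) * cubic_coeff (a * q) u v q r)"
    and "alpha2 a u v q (3 * r + 2) = 0"
proof -
  have power_3r: "q powi ((9 * (int r)\<^sup>2 - 13 * int r) div 2) = q ^ (3 * r choose 2) / q ^ (5 * r)"
    using power_cubic_exponent[OF assms, of r 5] by (simp add: power_mult[symmetric] mult.commute[of r])
  have "q powi ((9 * (int r)\<^sup>2 - int r) div 2) = q ^ (3 * r choose 2) * q ^ r"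
    using power_cubic_exponent[OF assms, of r "-1"] by (simp add: power_int_minus divide_inverse)
  moreover have "q ^ (6 * r) = q ^ (5 * r) * q ^ r"
    by (simp flip: power_add)
  ultimately have power_3r_plus_1:
    "q powi ((9 * (int r)\<^sup>2 - int r) div 2 + 1)
      = q ^ (3 * r choose 2) / q ^ (5 * r) * q ^ (6 * r) * q"
    using assms by (simp add: power_int_add)
  have "cubic_coeff (a * q) u v q r
      = A_coeff a u v q r * (q ^ (3 * r choose 2) / q ^ (5 * r)) * (- a) ^ r"
    using A_coeff_eq_cubic_coeff[OF assms, of a u v r] assms by simp
  then show "alpha2 a u v q (3 * r) = cubic_coeff (a * q) u v q r"
    "alpha2 a u v q (3 * r + 1) = - (a * q * q ^ (6 * r) * cubic_coeff (a * q) u v q r)"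
    "alpha2 a u v q (3 * r + 2) = 0"
    unfolding alpha2_def Let_def div_mod_3 power_3r power_3r_plus_1 by simp_all
qed

lemma alpha3_residues:
  assumes "q \<noteq> 0"
  shows "alpha3 a u v q (3 * r) = q ^ (3 * r) * cubic_coeff (a * q) u v q r"
    and "alpha3 a u v q (3 * r + 1) = - (q ^ (3 * r) * cubic_coeff (a * q) u v q r)"
    and "alpha3 a u v q (3 * r + 2) = 0"
proof -
  have "q ^ (5 * r) = q ^ (2 * r) * q ^ (3 * r)" by (simp flip: power_add)
  then have "A_coeff a u v q r * (q ^ (3 * r choose 2) / q ^ (2 * r)) * (- a) ^ r
      = q ^ (3 * r) * cubic_coeff (a * q) u v q r"
    using A_coeff_eq_cubic_coeff[OF assms, of a u v r] assms by simp
  moreover have "q powi ((9 * (int r)\<^sup>2 - 7 * int r) div 2) = q ^ (3 * r choose 2) / q ^ (2 * r)"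
    using power_cubic_exponent[OF assms, of r 2] by (simp add: power_mult[symmetric] mult.commute[of r])
  ultimately show "alpha3 a u v q (3 * r) = q ^ (3 * r) * cubic_coeff (a * q) u v q r"
    "alpha3 a u v q (3 * r + 1) = - (q ^ (3 * r) * cubic_coeff (a * q) u v q r)"
    "alpha3 a u v q (3 * r + 2) = 0"
    unfolding alpha3_def Let_def div_mod_3 by (simp_all add: mult_ac)
qed

lemma sum_atMost_by_residue_3:
  fixes f :: "nat \<Rightarrow> 'a::comm_monoid_add"
  assumes "\<And>r. f (3 * r + 2) = 0"
  shows "(\<Sum>j\<le>n. f j) = (\<Sum>r\<le>n div 3. f (3 * r) + (if 3 * r + 1 \<le> n then f (3 * r + 1) else 0))"
proof -
  define g where "g j = (if j \<le> n then f j else 0)" for j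
  have block: "(\<Sum>j = r * 3..<r * 3 + 3. g j) = g (3 * r) + g (3 * r + 1) + g (3 * r + 2)" for r
    by (simp add: eval_nat_numeral mult.commute[of r])
  have "(\<Sum>j\<le>n. f j) = (\<Sum>j<Suc (n div 3) * 3. g j)"
    by (rule sum.mono_neutral_cong_left) (auto simp: g_def)
  also have "\<dots> = (\<Sum>r<Suc (n div 3). \<Sum>j = r * 3..<r * 3 + 3. g j)"
    by (rule sum.nat_group[symmetric])
  also have "\<dots> = (\<Sum>r\<le>n div 3. f (3 * r) + (if 3 * r + 1 \<le> n then f (3 * r + 1) else 0))"
    unfolding block lessThan_Suc_atMost using assms by (intro sum.cong) (auto simp: g_def)
  finally show ?thesis .
qed

locale cubic_bailey = cubic_base +
  fixes u v :: complex
  assumes u_nonzero: "u \<noteq> 0" and v_nonzero: "v \<noteq> 0"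
    and uv_denominator_nonzero: "qpochs [u, v, a / u, a / v, q ^ 3] (q ^ 3) r \<noteq> 0"
    and K_den_nonzero:
      "K_den a (q powi (- int n)) (q powi (1 - int n)) (q powi (2 - int n)) a u v (q ^ 3) \<noteq> 0"
begin

lemma cubic_bailey_term:
  assumes "3 * r \<le> n"
  shows "(1 - a * q ^ (6 * r)) / (1 - a) * cubic_coeff a u v q r
           / (qpoch q q (n - 3 * r) * qpoch (a * q) q (n + 3 * r))
       = cubic_weight n r * uv_factor a u v (q ^ 3) r / (qpoch q q n * qpoch (a * q) q n)"
proof -
  have "(q ^ 3) ^ (2 * r) = q ^ (6 * r)"
    by (simp flip: power_mult)
  then have "cubic_coeff a u v q r
      = qpoch a (q ^ 3) r / qpoch (q ^ 3) (q ^ 3) r * q ^ (3 * r choose 2) * (- a) ^ r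
        * uv_factor a u v (q ^ 3) r"
    by (simp add: cubic_coeff_def uv_factor_def qpochs_def mult_ac)
  then have "(1 - a * q ^ (6 * r)) / (1 - a) * cubic_coeff a u v q r
           / (qpoch q q (n - 3 * r) * qpoch (a * q) q (n + 3 * r))
      = cubic_weight n r / (qpoch q q n * qpoch (a * q) q n) * uv_factor a u v (q ^ 3) r"
    unfolding cubic_weight_eq[OF assms] by simp
  then show ?thesis by simp
qed

lemma cubic_bailey_sum:
  "(\<Sum>r\<le>n div 3. (1 - a * q ^ (6 * r)) / (1 - a) * cubic_coeff a u v q r
        / (qpoch q q (n - 3 * r) * qpoch (a * q) q (n + 3 * r)))
   = K0 a u v q n * (qpoch a (q ^ 3) n / (qpoch a q (2 * n) * qpoch q q n))"
proof -
  interpret well_poised a "1 / q ^ n" "q / q ^ n" "q\<^sup>2 / q ^ n" "q ^ 3"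
    by (rule well_poised_cubic)
  have args: "q powi (- int n) = 1 / q ^ n" "q powi (1 - int n) = q / q ^ n"
    "q powi (2 - int n) = q\<^sup>2 / q ^ n"
    using q_nonzero by (simp_all add: power_int_diff power_int_minus divide_inverse)
  have termination_bound: "n < 3 * Suc (n div 3)" by simp
  have "a \<noteq> 1 / q ^ n"
    using a_q_power_neq_1[of n] q_nonzero by auto
  then have "(\<Sum>r\<le>n div 3. cubic_weight n r * uv_factor a u v (q ^ 3) r)
      = K0 a u v q n * (\<Sum>r\<le>n div 3. cubic_weight n r)"
    unfolding K0_def args
    using uv_denominator_nonzero K_den_nonzero[of n, unfolded args] u_nonzero v_nonzero
      cubic_numerators_terminate[OF termination_bound]
    by (intro vwp_sum_with_uv_factor) (auto simp: qpochs_def)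
  moreover have "(\<Sum>r\<le>n div 3. (1 - a * q ^ (6 * r)) / (1 - a) * cubic_coeff a u v q r
        / (qpoch q q (n - 3 * r) * qpoch (a * q) q (n + 3 * r)))
      = (\<Sum>r\<le>n div 3. cubic_weight n r * uv_factor a u v (q ^ 3) r)
          / (qpoch q q n * qpoch (a * q) q n)"
    unfolding sum_divide_distrib by (intro sum.cong refl cubic_bailey_term) auto
  ultimately show ?thesis
    unfolding cubic_weight_sum[OF termination_bound] using qpoch_a_q_power_nonzero[of 1 n] by simp
qed

lemma adjacent_terms:
  assumes "3 * r \<le> n"
  shows "s / (qpoch q q (n - 3 * r) * qpoch a q (n + 3 * r))
       + (if 3 * r + 1 \<le> n then t / (qpoch q q (n - (3 * r + 1)) * qpoch a q (n + (3 * r + 1)))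
          else 0)
     = (s * (1 - a * q ^ (n + 3 * r)) + t * (1 - q ^ (n - 3 * r)))
       / ((1 - a) * (qpoch q q (n - 3 * r) * qpoch (a * q) q (n + 3 * r)))"
proof -
  obtain k where n_eq: "n = k + 3 * r" using assms by (metis le_add_diff_inverse2)
  have split: "(1 - a) * qpoch (a * q) q (n + 3 * r)
      = qpoch a q (n + 3 * r) * (1 - a * q ^ (n + 3 * r))"
    by (rule qpoch_mult_base)
  have factor_nonzero: "qpoch a q (n + 3 * r) \<noteq> 0" "1 - a * q ^ (n + 3 * r) \<noteq> 0"
    using qpoch_a_q_power_nonzero[of 0] a_q_power_neq_1 by simp_all
  show ?thesis
  proof (cases k)
    case 0
    then show ?thesis using factor_nonzero unfolding mult.left_commute[of "1 - a"] split by (simp add: n_eq)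
  next
    case (Suc l)
    have "n - 3 * r = Suc l" "n - (3 * r + 1) = l" "3 * r + 1 \<le> n" using n_eq Suc by simp_all
    moreover have "qpoch q q l \<noteq> 0" "1 - q ^ Suc l \<noteq> 0"
      using qpoch_q_nonzero q_power_neq_1[of l] by simp_all
    ultimately show ?thesis
      using factor_nonzero unfolding mult.left_commute[of "1 - a"] split
      by (simp add: qpoch_Suc add_divide_distrib mult_ac)
  qed
qed

lemma adjacent_bailey_sum:
  assumes zero: "\<And>r. \<alpha> (3 * r + 2) = 0"
    and coeff: "\<And>r. 3 * r \<le> n \<Longrightarrow>
        \<alpha> (3 * r) * (1 - a * q ^ (n + 3 * r)) + \<alpha> (3 * r + 1) * (1 - q ^ (n - 3 * r))
        = w * ((1 - a * q ^ (6 * r)) * cubic_coeff a u v q r)"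
  shows "(\<Sum>j\<le>n. \<alpha> j / (qpoch q q (n - j) * qpoch a q (n + j)))
       = w * (K0 a u v q n * (qpoch a (q ^ 3) n / (qpoch a q (2 * n) * qpoch q q n)))"
proof -
  define f where "f j = \<alpha> j / (qpoch q q (n - j) * qpoch a q (n + j))" for j
  define s where "s r = (1 - a * q ^ (6 * r)) / (1 - a) * cubic_coeff a u v q r
      / (qpoch q q (n - 3 * r) * qpoch (a * q) q (n + 3 * r))" for r
  have "(\<Sum>j\<le>n. f j)
      = (\<Sum>r\<le>n div 3. f (3 * r) + (if 3 * r + 1 \<le> n then f (3 * r + 1) else 0))"
    by (rule sum_atMost_by_residue_3) (simp only: f_def zero div_0)
  also have "\<dots> = (\<Sum>r\<le>n div 3. w * s r)"
  proof (rule sum.cong)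
    fix r assume "r \<in> {..n div 3}"
    then have "3 * r \<le> n" by auto
    then show "f (3 * r) + (if 3 * r + 1 \<le> n then f (3 * r + 1) else 0) = w * s r"
      unfolding f_def s_def adjacent_terms[OF \<open>3 * r \<le> n\<close>] coeff[OF \<open>3 * r \<le> n\<close>] by simp
  qed simp
  finally show ?thesis
    unfolding f_def s_def sum_distrib_left[symmetric] cubic_bailey_sum .
qed

end

lemma generic1_imp_cubic_bailey:
  assumes "generic1 a u v q"
  shows "cubic_bailey a q u v"
proof
  have "1 - a \<noteq> 0" "qpoch q q n \<noteq> 0" "qpoch (a * q) q n \<noteq> 0" for n
    using assms by (simp_all add: generic1_def generic_common_def)
  then have "qpoch q q (Suc k) \<noteq> 0" "qpoch a q (Suc k) \<noteq> 0" for k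
    by (simp_all only: qpoch_Suc_left[of a] mult_eq_0_iff de_Morgan_disj simp_thms)
  then show "q ^ Suc k \<noteq> 1" "a * q ^ k \<noteq> 1" for k
    by (auto simp: qpoch_Suc)
qed (use assms in \<open>simp_all only: generic1_def generic_common_def simp_thms\<close>)

lemma generic2_imp_cubic_bailey:
  assumes "generic2 a u v q"
  shows "cubic_bailey (a * q) q u v"
proof
  have "qpoch q q (Suc k) \<noteq> 0" "qpoch (a * q) q (Suc k) \<noteq> 0" for k
    using assms by (simp_all only: generic2_def generic_common_def simp_thms)
  then show "q ^ Suc k \<noteq> 1" "a * q * q ^ k \<noteq> 1" for k
    by (auto simp: qpoch_Suc)
qed (use assms in \<open>simp_all only: generic2_def generic_common_def simp_thms\<close>)

lemma bailey_pairI: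
  assumes "\<alpha> 0 = 1"
    and "\<And>n. (\<Sum>j\<le>n. \<alpha> j / (qpoch q q (n - j) * qpoch (a * q) q (n + j))) = \<beta> n"
  shows "\<beta> 0 = 1 \<and> bailey_pair a q \<alpha> \<beta>"
  using assms assms(2)[of 0] by (simp add: bailey_pair_def)

lemma bailey_pair_alpha1_beta1:
  assumes "generic1 a u v q"
  shows "beta1 a u v q 0 = 1 \<and> bailey_pair a q (alpha1 a u v q) (beta1 a u v q)"
proof (rule bailey_pairI)
  interpret cubic_bailey a q u v
    using assms by (rule generic1_imp_cubic_bailey)
  note alpha = alpha1_residues[OF q_nonzero, of a u v]
  show "alpha1 a u v q 0 = 1"
    using a_q_power_neq_1[of 0] by (simp add: alpha1_def qpochs_def)
  show "(\<Sum>j\<le>n. alpha1 a u v q j / (qpoch q q (n - j) * qpoch (a * q) q (n + j)))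
      = beta1 a u v q n" for n
    unfolding beta1_def cubic_bailey_sum[symmetric]
    by (subst sum_atMost_by_residue_3) (simp_all only: alpha div_0 if_cancel add_0_right)
qed

lemma bailey_pair_alpha2_beta2:
  assumes "generic2 a u v q"
  shows "beta2 a u v q 0 = 1 \<and> bailey_pair a q (alpha2 a u v q) (beta2 a u v q)"
proof (rule bailey_pairI)
  interpret cubic_bailey "a * q" q u v
    using assms by (rule generic2_imp_cubic_bailey)
  note alpha = alpha2_residues[OF q_nonzero, of a u v]
  show "alpha2 a u v q 0 = 1"
    by (simp add: alpha2_def A_coeff_def qpochs_def)
  show "(\<Sum>j\<le>n. alpha2 a u v q j / (qpoch q q (n - j) * qpoch (a * q) q (n + j)))
      = beta2 a u v q n" for n
  proof -
    have coeff: "alpha2 a u v q (3 * r) * (1 - a * q * q ^ (n + 3 * r))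
          + alpha2 a u v q (3 * r + 1) * (1 - q ^ (n - 3 * r))
        = 1 * ((1 - a * q * q ^ (6 * r)) * cubic_coeff (a * q) u v q r)" if "3 * r \<le> n" for r
    proof -
      have "q ^ (n + 3 * r) = q ^ (6 * r) * q ^ (n - 3 * r)"
        using that by (simp add: add.commute flip: power_add)
      then show ?thesis unfolding alpha by (simp add: algebra_simps)
    qed
    have "(\<Sum>j\<le>n. alpha2 a u v q j / (qpoch q q (n - j) * qpoch (a * q) q (n + j)))
        = 1 * (K0 (a * q) u v q n
          * (qpoch (a * q) (q ^ 3) n / (qpoch (a * q) q (2 * n) * qpoch q q n)))"
      using alpha(3) coeff by (rule adjacent_bailey_sum)
    then show ?thesis by (simp add: beta2_def K0_def K0'_def)
  qed
qed

lemma bailey_pair_alpha3_beta3: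
  assumes "generic2 a u v q"
  shows "beta3 a u v q 0 = 1 \<and> bailey_pair a q (alpha3 a u v q) (beta3 a u v q)"
proof (rule bailey_pairI)
  interpret cubic_bailey "a * q" q u v
    using assms by (rule generic2_imp_cubic_bailey)
  note alpha = alpha3_residues[OF q_nonzero, of a u v]
  show "alpha3 a u v q 0 = 1"
    by (simp add: alpha3_def A_coeff_def qpochs_def)
  show "(\<Sum>j\<le>n. alpha3 a u v q j / (qpoch q q (n - j) * qpoch (a * q) q (n + j)))
      = beta3 a u v q n" for n
  proof -
    have coeff: "alpha3 a u v q (3 * r) * (1 - a * q * q ^ (n + 3 * r))
          + alpha3 a u v q (3 * r + 1) * (1 - q ^ (n - 3 * r))
        = q ^ n * ((1 - a * q * q ^ (6 * r)) * cubic_coeff (a * q) u v q r)" if "3 * r \<le> n" for r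
    proof -
      have "q ^ (n + 3 * r) = q ^ (6 * r) * q ^ (n - 3 * r)" "q ^ n = q ^ (3 * r) * q ^ (n - 3 * r)"
        using that by (simp_all add: add.commute flip: power_add)
      then show ?thesis unfolding alpha by (simp add: algebra_simps)
    qed
    have "(\<Sum>j\<le>n. alpha3 a u v q j / (qpoch q q (n - j) * qpoch (a * q) q (n + j)))
        = q ^ n * (K0 (a * q) u v q n
          * (qpoch (a * q) (q ^ 3) n / (qpoch (a * q) q (2 * n) * qpoch q q n)))"
      using alpha(3) coeff by (rule adjacent_bailey_sum)
    then show ?thesis by (simp add: beta3_def K0_def K0'_def)
  qed
qed

theorem theorem2p3:
  fixes a u v q :: complex
  shows "(generic1 a u v q \<longrightarrow>
            beta1 a u v q 0 = 1 \<and> bailey_pair a q (alpha1 a u v q) (beta1 a u v q)) \<and>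
         (generic2 a u v q \<longrightarrow>
            beta2 a u v q 0 = 1 \<and> bailey_pair a q (alpha2 a u v q) (beta2 a u v q)) \<and>
         (generic2 a u v q \<longrightarrow>
            beta3 a u v q 0 = 1 \<and> bailey_pair a q (alpha3 a u v q) (beta3 a u v q))"
  using bailey_pair_alpha1_beta1 bailey_pair_alpha2_beta2 bailey_pair_alpha3_beta3 by blast

end
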